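(* Let $g>0$, $H>0$, $U\in\mathbb R$, $x_L<0<x_R$, $\Omega^-=[x_L,0]$, $\Omega^+=[0,x_R]$, $\Omega=\Omega^-\cup\Omega^+$. Let $h^{\pm},u^{\pm}$ be sufficiently smooth real-valued solutions on $\Omega^{\pm}\times[0,\infty)$ of $$\frac{\partial h^{\pm}}{\partial t}+\frac{\partial}{\partial x}F_h(h^{\pm},u^{\pm})=0,\qquad\frac{\partial u^{\pm}}{\partial t}+\frac{\partial}{\partial x}F_u(h^{\pm},u^{\pm})=0,$$ where $F_h(h,u)=Uh+Hu$ and $F_u(h,u)=gh+Uu-\frac{H^2U}{3}\frac{\partial^2u}{\partial x^2}-\frac{H^2}{3}\frac{\partial^2u}{\partial x\partial t}$. Assume that the jumps of the fluxes vanish at the interface $x=0$ for all $t\ge 0$: $[\![F_h(h,u)]\!]=0$ and $[\![F_u(h,u)]\!]=0$. If $F_h(h,u)\big|_{x=x_L}^{x=x_R}=0$ and $F_u(h,u)\big|_{x=x_L}^{x=x_R}=0$ for all $t\ge 0$, then $$\frac{d}{dt}(g,h)_{\Omega}=0,\qquad\frac{d}{dt}(H,u)_{\Omega}=0.$$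
   Context: For a quantity $v$ with values $v^-$ on $\Omega^-$ and $v^+$ on $\Omega^+$, the jump is $[\![v]\!]=v^+-v^-$ at $x=0$; thus $[\![F_h(h,u)]\!]=F_h(h^+,u^+)-F_h(h^-,u^-)$ at $x=0$, and similarly for $F_u$. The functions $h,u$ on $\Omega$ equal $h^{\pm},u^{\pm}$ on $\Omega^{\pm}$, and $v|_{x=x_L}^{x=x_R}=v^+(x_R,t)-v^-(x_L,t)$. $(\cdot,\cdot)_\Omega$ is the $L^2(\Omega)$ inner product; the constants $g,H$ are regarded as constant functions. "Sufficiently smooth" means that all partial derivatives appearing exist, are continuous up to the boundary of each subdomain, and mixed partials commute. *)

theory Defs
  imports "HOL-Analysis.Analysis"
begin

(* Fields are curried functions of (x, t) and only their values on I \<times> [0,\<infinity>) matter.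
   Partial derivatives are taken within I and within [0,\<infinity>), hence are one-sided at the end
   points of I (in particular at the interface) and at t = 0. *)

definition partial_x :: "real set \<Rightarrow> (real \<Rightarrow> real \<Rightarrow> real) \<Rightarrow> real \<Rightarrow> real \<Rightarrow> real" where
  "partial_x I v x t = vector_derivative (\<lambda>\<xi>. v \<xi> t) (at x within I)"

definition partial_t :: "(real \<Rightarrow> real \<Rightarrow> real) \<Rightarrow> real \<Rightarrow> real \<Rightarrow> real" where
  "partial_t v x t = vector_derivative (\<lambda>\<tau>. v x \<tau>) (at t within {0..})"

definition cont_field :: "real set \<Rightarrow> (real \<Rightarrow> real \<Rightarrow> real) \<Rightarrow> bool" where
  "cont_field I v \<longleftrightarrow> continuous_on (I \<times> {0..}) (\<lambda>(x, t). v x t)"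

definition cont_diff_x :: "real set \<Rightarrow> (real \<Rightarrow> real \<Rightarrow> real) \<Rightarrow> bool" where
  "cont_diff_x I v \<longleftrightarrow>
     (\<forall>x\<in>I. \<forall>t\<ge>0. (\<lambda>\<xi>. v \<xi> t) differentiable (at x within I)) \<and>
     cont_field I (partial_x I v)"

definition cont_diff_t :: "real set \<Rightarrow> (real \<Rightarrow> real \<Rightarrow> real) \<Rightarrow> bool" where
  "cont_diff_t I v \<longleftrightarrow>
     (\<forall>x\<in>I. \<forall>t\<ge>0. (\<lambda>\<tau>. v x \<tau>) differentiable (at t within {0..})) \<and>
     cont_field I (partial_t v)"

definition agree_on :: "real set \<Rightarrow> (real \<Rightarrow> real \<Rightarrow> real) \<Rightarrow> (real \<Rightarrow> real \<Rightarrow> real) \<Rightarrow> bool" where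
  "agree_on I v w \<longleftrightarrow> (\<forall>x\<in>I. \<forall>t\<ge>0. v x t = w x t)"

(* The system contains h_t, h_x, u_t, u_x, u_xx, u_xt, u_xxx, u_xxt; every order of
   differentiation of the mixed ones is required to exist, be continuous, and agree. *)

definition smooth_h :: "real set \<Rightarrow> (real \<Rightarrow> real \<Rightarrow> real) \<Rightarrow> bool" where
  "smooth_h I h \<longleftrightarrow> cont_field I h \<and> cont_diff_x I h \<and> cont_diff_t I h"

definition smooth_u :: "real set \<Rightarrow> (real \<Rightarrow> real \<Rightarrow> real) \<Rightarrow> bool" where
  "smooth_u I u \<longleftrightarrow>
     cont_field I u \<and> cont_diff_x I u \<and> cont_diff_t I u \<and>
     cont_diff_x I (partial_x I u) \<and>
     cont_diff_t I (partial_x I u) \<and>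
     cont_diff_x I (partial_t u) \<and>
     cont_diff_x I (partial_x I (partial_x I u)) \<and>
     cont_diff_t I (partial_x I (partial_x I u)) \<and>
     cont_diff_x I (partial_t (partial_x I u)) \<and>
     cont_diff_x I (partial_x I (partial_t u)) \<and>
     agree_on I (partial_x I (partial_t u)) (partial_t (partial_x I u)) \<and>
     agree_on I (partial_x I (partial_x I (partial_t u))) (partial_x I (partial_t (partial_x I u))) \<and>
     agree_on I (partial_x I (partial_t (partial_x I u))) (partial_t (partial_x I (partial_x I u)))"

definition flux_h ::
  "real \<Rightarrow> real \<Rightarrow> (real \<Rightarrow> real \<Rightarrow> real) \<Rightarrow> (real \<Rightarrow> real \<Rightarrow> real) \<Rightarrow> real \<Rightarrow> real \<Rightarrow> real" where
  "flux_h H U h u x t = U * h x t + H * u x t"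

definition flux_u ::
  "real \<Rightarrow> real \<Rightarrow> real \<Rightarrow> real set \<Rightarrow> (real \<Rightarrow> real \<Rightarrow> real) \<Rightarrow> (real \<Rightarrow> real \<Rightarrow> real)
     \<Rightarrow> real \<Rightarrow> real \<Rightarrow> real" where
  "flux_u g H U I h u x t =
     g * h x t + U * u x t
     - H\<^sup>2 * U / 3 * partial_x I (partial_x I u) x t
     - H\<^sup>2 / 3 * partial_x I (partial_t u) x t"

definition jump :: "(real \<Rightarrow> real \<Rightarrow> real) \<Rightarrow> (real \<Rightarrow> real \<Rightarrow> real) \<Rightarrow> real \<Rightarrow> real" where
  "jump vm vp t = vp 0 t - vm 0 t"

definition boundary_diff ::
  "real \<Rightarrow> real \<Rightarrow> (real \<Rightarrow> real \<Rightarrow> real) \<Rightarrow> (real \<Rightarrow> real \<Rightarrow> real) \<Rightarrow> real \<Rightarrow> real" where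
  "boundary_diff xL xR vm vp t = vp xR t - vm xL t"

(* The two traces may differ at x = 0; the choice there does not affect integrals over \<Omega>. *)
definition glue ::
  "(real \<Rightarrow> real \<Rightarrow> real) \<Rightarrow> (real \<Rightarrow> real \<Rightarrow> real) \<Rightarrow> real \<Rightarrow> real \<Rightarrow> real" where
  "glue vm vp x t = (if x < 0 then vm x t else vp x t)"

definition L2_inner :: "real set \<Rightarrow> (real \<Rightarrow> real) \<Rightarrow> (real \<Rightarrow> real) \<Rightarrow> real" where
  "L2_inner S v w = (LINT x:S|lborel. v x * w x)"

end

theory Submission
  imports Defs
begin

text \<open>
  On each subdomain, differentiating under the integral sign and integrating the equation in space
  shows that the rate of change of the integral of a conserved quantity is the flux entering at the
  left end minus the flux leaving at the right end. Summing the two subdomains, the fluxes at the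
  interface cancel by the jump condition and those at the outer ends by the boundary condition.
\<close>

lemma partial_t_has_vector_derivative:
  assumes "cont_diff_t I v" "x \<in> I" "t \<ge> 0"
  shows "((\<lambda>\<tau>. v x \<tau>) has_vector_derivative partial_t v x t) (at t within {0..})"
  using assms by (simp add: cont_diff_t_def partial_t_def vector_derivative_works)

lemma cont_field_slice:
  assumes "cont_field I v" "t \<ge> 0"
  shows "continuous_on I (\<lambda>x. v x t)"
proof -
  have "continuous_on I (\<lambda>x. case (x, t) of (x, t) \<Rightarrow> v x t)"
    by (rule continuous_on_compose2[OF assms(1)[unfolded cont_field_def]])
       (use assms(2) in \<open>auto intro!: continuous_intros\<close>)
  then show ?thesis by simp
qed

lemma flux_h_differentiable:
  assumes "smooth_h I h" "smooth_u I u" "x \<in> I" "t \<ge> 0"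
  shows "(\<lambda>\<xi>. flux_h H U h u \<xi> t) differentiable (at x within I)"
  using assms unfolding flux_h_def smooth_h_def smooth_u_def cont_diff_x_def
  by (auto intro!: derivative_intros)

text \<open>\<open>flux_u\<close> already contains the second-order terms u_xx and u_xt, so its
  differentiability in x rests on the third-order conditions in \<open>smooth_u\<close>.\<close>

lemma flux_u_differentiable:
  assumes "smooth_h I h" "smooth_u I u" "x \<in> I" "t \<ge> 0"
  shows "(\<lambda>\<xi>. flux_u g H U I h u \<xi> t) differentiable (at x within I)"
proof -
  have "(\<lambda>\<xi>. h \<xi> t) differentiable (at x within I)"
    "(\<lambda>\<xi>. u \<xi> t) differentiable (at x within I)"
    "(\<lambda>\<xi>. partial_x I (partial_x I u) \<xi> t) differentiable (at x within I)"
    "(\<lambda>\<xi>. partial_x I (partial_t u) \<xi> t) differentiable (at x within I)"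
    using assms unfolding smooth_h_def smooth_u_def cont_diff_x_def by blast+
  then show ?thesis
    unfolding flux_u_def by (intro derivative_intros)
qed

text \<open>The balance law for a single interval, for an arbitrary density \<open>v\<close> and
  flux \<open>F\<close>. Mere differentiability of \<open>F\<close> in x suffices because the
  fundamental theorem of calculus for the gauge integral asks for no continuity of the derivative.
  At t = 0 the time derivative is one-sided.\<close>

lemma conservation_law_integral_derivative:
  fixes v F :: "real \<Rightarrow> real \<Rightarrow> real"
  assumes ab: "a \<le> b" and t: "t \<ge> 0"
    and cont: "cont_field {a..b} v" and diff: "cont_diff_t {a..b} v"
    and F: "\<And>x. x \<in> {a..b} \<Longrightarrow> (\<lambda>\<xi>. F \<xi> t) differentiable (at x within {a..b})"
    and law: "\<And>x. x \<in> {a..b} \<Longrightarrow> partial_t v x t + partial_x {a..b} F x t = 0"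
  shows "((\<lambda>\<tau>. integral {a..b} (\<lambda>x. v x \<tau>)) has_real_derivative F a t - F b t)
           (at t within {0..})"
proof -
  have "continuous_on ({a..b} \<times> {0..}) (\<lambda>(x, t). partial_t v x t)"
    using diff by (simp add: cont_diff_t_def cont_field_def)
  \<comment> \<open>The Leibniz rule takes the parameter as first component and the integration
    variable as second, whereas fields list space before time.\<close>
  then have "continuous_on ({0..} \<times> {a..b})
      (\<lambda>z. case prod.swap z of (x, t) \<Rightarrow> partial_t v x t)"
    by (rule continuous_on_compose2) (auto intro!: continuous_on_swap)
  then have "continuous_on ({0..} \<times> {a..b}) (\<lambda>(t, x). partial_t v x t)"
    by (simp add: case_prod_beta)
  then have "((\<lambda>\<tau>. integral (cbox a b) (\<lambda>x. v x \<tau>)) has_vector_derivative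
      integral (cbox a b) (\<lambda>x. partial_t v x t)) (at t within {0..})"
    using partial_t_has_vector_derivative[OF diff] cont_field_slice[OF cont] t
    by (intro leibniz_rule_vector_derivative)
       (auto intro!: integrable_continuous_real)
  moreover have "integral {a..b} (\<lambda>x. partial_t v x t) = F a t - F b t"
  proof -
    have "((\<lambda>x. partial_x {a..b} F x t) has_integral F b t - F a t) {a..b}"
      using F by (intro fundamental_theorem_of_calculus[OF ab])
        (simp add: partial_x_def vector_derivative_works)
    \<comment> \<open>The law gives \<open>partial_t v x t = - partial_x {a..b} F x t\<close>
      pointwise, so negating the flux integral yields the integral of the time derivative.\<close>
    from has_integral_neg[OF this]
    have "((\<lambda>x. partial_t v x t) has_integral F a t - F b t) {a..b}"
      by (rule has_integral_eq_rhs[OF has_integral_eq[rotated]])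
         (use law in \<open>auto simp: add_eq_0_iff2\<close>)
    then show ?thesis by (rule integral_unique)
  qed
  ultimately show ?thesis
    by (simp add: has_real_derivative_iff_has_vector_derivative)
qed

text \<open>Connects the Lebesgue inner product over the whole domain with gauge integrals over the
  two pieces, to which the Leibniz rule applies.\<close>

lemma L2_inner_const_glue:
  assumes xL: "xL < 0" and xR: "0 < xR"
    and vm: "continuous_on {xL..0} (\<lambda>x. vm x t)"
    and vp: "continuous_on {0..xR} (\<lambda>x. vp x t)"
  shows "L2_inner ({xL..0} \<union> {0..xR}) (\<lambda>x. c) (\<lambda>x. glue vm vp x t) =
    c * (integral {xL..0} (\<lambda>x. vm x t) + integral {0..xR} (\<lambda>x. vp x t))"
proof -
  let ?v = "\<lambda>x. glue vm vp x t"
  have im: "set_integrable lborel {xL..0} (\<lambda>x. vm x t)"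
    and ip: "set_integrable lborel {0..xR} (\<lambda>x. vp x t)"
    using vm vp by (simp_all add: borel_integrable_atLeastAtMost')
  \<comment> \<open>At 0 \<open>glue\<close> takes the right trace, so it agrees with
    \<open>vm\<close> only on the half-open interval.\<close>
  have im': "set_integrable lborel {xL..<0} (\<lambda>x. vm x t)"
    by (rule set_integrable_subset[OF im]) auto
  have gm: "set_integrable lborel {xL..<0} ?v"
    using im' by (rule set_integrable_cong[THEN iffD1, rotated 3]) (auto simp: glue_def)
  have gp: "set_integrable lborel {0..xR} ?v"
    using ip by (rule set_integrable_cong[THEN iffD1, rotated 3]) (auto simp: glue_def)
  have "(LINT x:{xL..<0}|lborel. ?v x) = (LINT x:{xL..<0}|lborel. vm x t)"
    by (rule set_lebesgue_integral_cong) (auto simp: glue_def)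
  \<comment> \<open>Restoring the end point 0 changes nothing, since a singleton is a null
    set.\<close>
  also have "\<dots> = (LINT x:{xL..0}|lborel. vm x t)"
  proof (rule set_integral_cong_set)
    show "AE x in lborel. x \<in> {xL..0} \<longleftrightarrow> x \<in> {xL..<0}"
      using AE_lborel_singleton[of 0] by eventually_elim auto
  qed (use im im' in \<open>auto simp: set_borel_measurable_def set_integrable_def\<close>)
  also have "\<dots> = integral {xL..0} (\<lambda>x. vm x t)"
    by (rule set_borel_integral_eq_integral(2)[OF im])
  finally have m: "(LINT x:{xL..<0}|lborel. ?v x) = integral {xL..0} (\<lambda>x. vm x t)" .
  have "(LINT x:{0..xR}|lborel. ?v x) = (LINT x:{0..xR}|lborel. vp x t)"
    by (rule set_lebesgue_integral_cong) (auto simp: glue_def)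
  then have p: "(LINT x:{0..xR}|lborel. ?v x) = integral {0..xR} (\<lambda>x. vp x t)"
    by (simp add: set_borel_integral_eq_integral(2)[OF ip])
  \<comment> \<open>The closed pieces share the point 0; this form of the union is disjoint, as
    additivity of the integral requires.\<close>
  have "{xL..0} \<union> {0..xR} = {xL..<0} \<union> {0..xR}"
    using xL xR by auto
  then have "(LINT x:{xL..0} \<union> {0..xR}|lborel. ?v x) =
      (LINT x:{xL..<0}|lborel. ?v x) + (LINT x:{0..xR}|lborel. ?v x)"
    by (simp only:) (rule set_integral_Un[OF _ gm gp], auto)
  then show ?thesis
    by (simp add: L2_inner_def m p)
qed

text \<open>Stated for an arbitrary constant weight \<open>c\<close> and arbitrary fluxes, so that
  both conclusions of the theorem are instances: \<open>c\<close> is \<open>g\<close> for the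
  h-equation and \<open>H\<close> for the u-equation.\<close>

lemma glued_conservation_law:
  fixes vm vp Fm Fp :: "real \<Rightarrow> real \<Rightarrow> real"
  assumes xL: "xL < 0" and xR: "0 < xR" and t: "t \<ge> 0"
    and vm: "cont_field {xL..0} vm" "cont_diff_t {xL..0} vm"
    and vp: "cont_field {0..xR} vp" "cont_diff_t {0..xR} vp"
    and Fm: "\<And>x. x \<in> {xL..0} \<Longrightarrow> (\<lambda>\<xi>. Fm \<xi> t) differentiable (at x within {xL..0})"
    and Fp: "\<And>x. x \<in> {0..xR} \<Longrightarrow> (\<lambda>\<xi>. Fp \<xi> t) differentiable (at x within {0..xR})"
    and lawm: "\<And>x. x \<in> {xL..0} \<Longrightarrow> partial_t vm x t + partial_x {xL..0} Fm x t = 0"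
    and lawp: "\<And>x. x \<in> {0..xR} \<Longrightarrow> partial_t vp x t + partial_x {0..xR} Fp x t = 0"
    and jump: "jump Fm Fp t = 0" and boundary: "boundary_diff xL xR Fm Fp t = 0"
  shows "((\<lambda>\<tau>. L2_inner ({xL..0} \<union> {0..xR}) (\<lambda>x. c) (\<lambda>x. glue vm vp x \<tau>))
           has_real_derivative 0) (at t within {0..})"
proof -
  have "((\<lambda>\<tau>. c * (integral {xL..0} (\<lambda>x. vm x \<tau>) + integral {0..xR} (\<lambda>x. vp x \<tau>)))
      has_real_derivative c * ((Fm xL t - Fm 0 t) + (Fp 0 t - Fp xR t))) (at t within {0..})"
    using xL xR t vm vp Fm Fp lawm lawp
    by (intro DERIV_cmult DERIV_add conservation_law_integral_derivative) auto
  \<comment> \<open>The jump condition gives \<open>Fp 0 t = Fm 0 t\<close>, and the boundary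
    condition gives \<open>Fp xR t = Fm xL t\<close>.\<close>
  moreover have "(Fm xL t - Fm 0 t) + (Fp 0 t - Fp xR t) = 0"
    using jump boundary by (simp add: jump_def boundary_diff_def)
  ultimately have "((\<lambda>\<tau>. c * (integral {xL..0} (\<lambda>x. vm x \<tau>) + integral {0..xR} (\<lambda>x. vp x \<tau>)))
      has_real_derivative 0) (at t within {0..})"
    by simp
  \<comment> \<open>The inner product is known to equal the sum of integrals only at times \<ge> 0,
    where the fields are continuous. Equality within \<open>{0..}\<close> is enough to transfer the
    derivative; the radius 1 is arbitrary.\<close>
  then show ?thesis
    by (rule has_field_derivative_transform_within[OF _ zero_less_one])
       (use t xL xR vm vp in \<open>auto simp: L2_inner_const_glue cont_field_slice\<close>)
qed

theorem theorem4:
  fixes g H U xL xR :: real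
    and hm hp um up :: "real \<Rightarrow> real \<Rightarrow> real"
    and \<Omega>m \<Omega>p \<Omega> :: "real set"
  assumes "g > 0" and "H > 0" and "xL < 0" and "0 < xR"
    and "\<Omega>m = {xL..0}" and "\<Omega>p = {0..xR}" and "\<Omega> = \<Omega>m \<union> \<Omega>p"
    and "smooth_h \<Omega>m hm" and "smooth_u \<Omega>m um"
    and "smooth_h \<Omega>p hp" and "smooth_u \<Omega>p up"
    and "\<And>x t. x \<in> \<Omega>m \<Longrightarrow> t \<ge> 0 \<Longrightarrow>
           partial_t hm x t + partial_x \<Omega>m (flux_h H U hm um) x t = 0"
    and "\<And>x t. x \<in> \<Omega>m \<Longrightarrow> t \<ge> 0 \<Longrightarrow>
           partial_t um x t + partial_x \<Omega>m (flux_u g H U \<Omega>m hm um) x t = 0"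
    and "\<And>x t. x \<in> \<Omega>p \<Longrightarrow> t \<ge> 0 \<Longrightarrow>
           partial_t hp x t + partial_x \<Omega>p (flux_h H U hp up) x t = 0"
    and "\<And>x t. x \<in> \<Omega>p \<Longrightarrow> t \<ge> 0 \<Longrightarrow>
           partial_t up x t + partial_x \<Omega>p (flux_u g H U \<Omega>p hp up) x t = 0"
    and "\<And>t. t \<ge> 0 \<Longrightarrow> jump (flux_h H U hm um) (flux_h H U hp up) t = 0"
    and "\<And>t. t \<ge> 0 \<Longrightarrow> jump (flux_u g H U \<Omega>m hm um) (flux_u g H U \<Omega>p hp up) t = 0"
    and "\<And>t. t \<ge> 0 \<Longrightarrow> boundary_diff xL xR (flux_h H U hm um) (flux_h H U hp up) t = 0"
    and "\<And>t. t \<ge> 0 \<Longrightarrow>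
           boundary_diff xL xR (flux_u g H U \<Omega>m hm um) (flux_u g H U \<Omega>p hp up) t = 0"
  shows "(\<forall>t\<ge>0. ((\<lambda>\<tau>. L2_inner \<Omega> (\<lambda>x. g) (\<lambda>x. glue hm hp x \<tau>)) has_real_derivative 0)
                  (at t within {0..})) \<and>
         (\<forall>t\<ge>0. ((\<lambda>\<tau>. L2_inner \<Omega> (\<lambda>x. H) (\<lambda>x. glue um up x \<tau>)) has_real_derivative 0)
                  (at t within {0..}))"
proof -
  note hm = \<open>smooth_h \<Omega>m hm\<close> and um = \<open>smooth_u \<Omega>m um\<close>
    and hp = \<open>smooth_h \<Omega>p hp\<close> and up = \<open>smooth_u \<Omega>p up\<close>
  note sets = \<open>\<Omega>m = {xL..0}\<close> \<open>\<Omega>p = {0..xR}\<close> \<open>\<Omega> = \<Omega>m \<union> \<Omega>p\<close>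
  have cont: "cont_field \<Omega>m hm" "cont_diff_t \<Omega>m hm" "cont_field \<Omega>p hp" "cont_diff_t \<Omega>p hp"
    "cont_field \<Omega>m um" "cont_diff_t \<Omega>m um" "cont_field \<Omega>p up" "cont_diff_t \<Omega>p up"
    using hm hp um up by (simp_all add: smooth_h_def smooth_u_def)
  show ?thesis
  proof (intro conjI allI impI)
    fix t :: real assume t: "t \<ge> 0"
    show "((\<lambda>\<tau>. L2_inner \<Omega> (\<lambda>x. g) (\<lambda>x. glue hm hp x \<tau>)) has_real_derivative 0)
        (at t within {0..})"
      unfolding sets
      by (rule glued_conservation_law[where Fm = "flux_h H U hm um" and Fp = "flux_h H U hp up"])
         (fact assms(3,4) t cont[unfolded sets] assms(16)[OF t] assms(18)[OF t]
           flux_h_differentiable[OF hm um _ t, unfolded sets]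
           flux_h_differentiable[OF hp up _ t, unfolded sets]
           assms(12)[OF _ t, unfolded sets] assms(14)[OF _ t, unfolded sets])+
    \<comment> \<open>Unlike \<open>flux_h\<close>, \<open>flux_u\<close> takes the subdomain as an
      argument, so the instantiated rule must have its sets unfolded too before its premises match
      the facts.\<close>
    show "((\<lambda>\<tau>. L2_inner \<Omega> (\<lambda>x. H) (\<lambda>x. glue um up x \<tau>)) has_real_derivative 0)
        (at t within {0..})"
      unfolding sets
      by (rule glued_conservation_law[where Fm = "flux_u g H U \<Omega>m hm um"
            and Fp = "flux_u g H U \<Omega>p hp up", unfolded sets])
         (fact assms(3,4) t cont[unfolded sets] assms(17)[OF t, unfolded sets]
           assms(19)[OF t, unfolded sets]
           flux_u_differentiable[OF hm um _ t, unfolded sets]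
           flux_u_differentiable[OF hp up _ t, unfolded sets]
           assms(13)[OF _ t, unfolded sets] assms(15)[OF _ t, unfolded sets])+
  qed
qed

end
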